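(* Let $\mathsf P,\mathsf H$ be Polish spaces, let $\ell:\mathbb R^n\times\mathsf P\to[0,+\infty]$ and $\mathcal A:\mathsf H\times\mathbb R^n\times\mathsf P\to\mathbb R^n$ be measurable, and fix $x^{(0)}\in\mathbb R^n$. Let $P,P_1,\dots,P_N$ be i.i.d. $\mathsf P$-valued random variables, put $D=(P_1,\dots,P_N)$, and let $H$ be an $\mathsf H$-valued random variable independent of $D$ and of $P$. Let $g:\mathsf P\to\mathbb R$ be measurable with $\mathbb E_P[g^2]<\infty$, and assume that the sublevel probability $\pi$ satisfies $\mathbb P_H\{\pi>0\}=1$. Let $\Gamma\subset(0,\infty)$ be compact, and assume that there are a finite covering $\mathcal O=\{\mathsf O_1,\dots,\mathsf O_K\}$ of $\Gamma$ by subsets of $\Gamma$ and a constant $C_{\mathcal O}$ such that for every $d\in\mathsf P^N$ $$\max_{i=1,\dots,K}\ \sup_{\gamma,\gamma'\in\mathsf O_i}\kappa(\gamma,d)-\kappa(\gamma',d)\le C_{\mathcal O}.$$ Then for every $\varepsilon>0$, with probability at least $1-\varepsilon$ over $D$, the following holds simultaneously for all $\gamma\in\Gamma$ and all probability measures $\mathbb Q$ on $\mathsf H$ with $\mathbb Q\ll\mathbb P_H$: $$\mathbb Q[\mathcal R_g]\ \le\ \mathbb Q[\hat{\mathcal R}_g(\cdot,D)]+\frac{D_{\mathrm{KL}}(\mathbb Q\,\|\,\mathbb P_H)+\log\left(\frac K\varepsilon\right)+C_{\mathcal O}}{\gamma}+\frac{\gamma}{2N}\int_{\mathsf H}\frac{\mathbb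 E_P\left[g^2\mathbf 1_{\mathsf L_{g,h}}\right]}{\pi(h)^2}\,\mathbb Q(dh).$$
   Context: Spaces carry their Borel $\sigma$-algebras and products carry product $\sigma$-algebras. All random variables live on one probability space $(\Omega,\mathcal F,\mathbb P)$; $\mathbb P_X$ is the law of $X$, $\mathbb E_P$ is integration with respect to $\mathbb P_P$, and $\mathbb Q[f]=\int f\,d\mathbb Q$. Write $\ell(h,p):=\ell(\mathcal A(h,x^{(0)},p),p)$ for $h\in\mathsf H$, $p\in\mathsf P$. Sublevel set: $\mathsf L_g:=\{(h,p)\in\mathsf H\times\mathsf P:\ell(h,p)\le g(p)\}$, with sections $\mathsf L_{g,h}:=\{p\in\mathsf P:(h,p)\in\mathsf L_g\}$. Sublevel probability: $\pi(h):=\mathbb P_{P\mid H=h}[\mathsf L_{g,h}]$, where $\mathbb P_{P\mid H=h}$ is a regular conditional distribution of $P$ given $H$; since $P$ and $H$ are independent, $\pi(h)=\mathbb P_P[\mathsf L_{g,h}]$ for $\mathbb P_H$-a.e. $h$. Sublevel risk: $\mathcal R_g(h):=\frac1{\pi(h)}\mathbb E_P[\ell(h,\cdot)\mathbf 1_{\mathsf L_{g,h}}]$ if $\pi(h)>0$ and $\mathcal R_g(h):=0$ otherwise. Empirical sublevel risk: $\hat{\mathcal R}_g(h,d):=\frac{1}{\pi(h)}\frac1N\sum_{i=1}^N\mathbf 1_{\mathsf L_{g,h}}(p_i)\,\ell(h,p_i)$ for $d=(p_1,\dots,p_N)$ (with $\pi(h)>0$ for $\mathbb P_H$-a.e. $h$).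 With $\eta(\gamma):=(\gamma,-\gamma^2/2)$ and $T(h,d):=\left(\mathcal R_g(h)-\hat{\mathcal R}_g(h,d),\ \frac{1}{\pi(h)^2N}\mathbb E_P[g^2\mathbf 1_{\mathsf L_{g,h}}]\right)$, set $\kappa(\gamma,d):=\log\int_{\mathsf H}\exp(\langle\eta(\gamma),T(h,d)\rangle)\,\mathbb P_H(dh)$; it is assumed that this integral lies in $(0,\infty)$ for all $\gamma\in\Gamma$, $d\in\mathsf P^N$. $D_{\mathrm{KL}}(\mathbb Q\|\mathbb P_H)=\mathbb Q[\log f]$ if $\mathbb Q\ll\mathbb P_H$ with density $f$, and $+\infty$ otherwise. *)

theory Defs
  imports "HOL-Probability.Probability"
begin

(* Integral of a real function with values in [-\<infinity>, \<infinity>]. The Bochner integral would return 0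
   for a function that is not integrable, so it does not give the value \<infinity>. The difference is only
   meaningful if one of the two parts is finite, as it is wherever the integral is used below. *)
definition ext_integral :: "'a measure \<Rightarrow> ('a \<Rightarrow> real) \<Rightarrow> ereal" where
  "ext_integral Q f =
     enn2ereal (\<integral>\<^sup>+ x. ennreal (f x) \<partial>Q) - enn2ereal (\<integral>\<^sup>+ x. ennreal (- f x) \<partial>Q)"

(* The library's KL_divergence is a Bochner integral, hence 0 when the divergence is infinite.
   With \<mu> dominating Q, entropy_density (exp 1) \<mu> Q is the natural logarithm of dQ/d\<mu>. *)
definition KL_div :: "'a measure \<Rightarrow> 'a measure \<Rightarrow> ereal" where
  "KL_div Q \<mu> =
     (if absolutely_continuous \<mu> Q then ext_integral Q (entropy_density (exp 1) \<mu> Q) else \<infinity>)"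

(* prob_space.indep_var requires both random variables to have the same type of values. *)
definition indep_rv ::
  "'w measure \<Rightarrow> 'a measure \<Rightarrow> ('w \<Rightarrow> 'a) \<Rightarrow> 'b measure \<Rightarrow> ('w \<Rightarrow> 'b) \<Rightarrow> bool" where
  "indep_rv M S X T Y \<longleftrightarrow>
     X \<in> M \<rightarrow>\<^sub>M S \<and> Y \<in> M \<rightarrow>\<^sub>M T \<and>
     prob_space.indep_set M {X -` A \<inter> space M | A. A \<in> sets S} {Y -` B \<inter> space M | B. B \<in> sets T}"

definition regular_cond_distr ::
  "'w measure \<Rightarrow> 'p measure \<Rightarrow> ('w \<Rightarrow> 'p) \<Rightarrow> 'h measure \<Rightarrow> ('w \<Rightarrow> 'h) \<Rightarrow> ('h \<Rightarrow> 'p measure) \<Rightarrow> bool"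
where
  "regular_cond_distr M S P T H \<kappa> \<longleftrightarrow>
     \<kappa> \<in> T \<rightarrow>\<^sub>M prob_algebra S \<and>
     (\<forall>A\<in>sets T. \<forall>B\<in>sets S.
        emeasure M {\<omega> \<in> space M. H \<omega> \<in> A \<and> P \<omega> \<in> B}
          = (\<integral>\<^sup>+ h. emeasure (\<kappa> h) B * indicator A h \<partial>distr M T H))"

definition loss ::
  "('x \<times> 'p \<Rightarrow> ennreal) \<Rightarrow> ('h \<times> 'x \<times> 'p \<Rightarrow> 'x) \<Rightarrow> 'x \<Rightarrow> 'h \<Rightarrow> 'p \<Rightarrow> ennreal" where
  "loss l A x0 h p = l (A (h, x0, p), p)"

(* The comparison is made in ereal: ennreal (g p) would cut off negative values of g at 0. *)
definition sublevel_set :: "('h \<Rightarrow> 'p \<Rightarrow> ennreal) \<Rightarrow> ('p \<Rightarrow> real) \<Rightarrow> ('h \<times> 'p) set" where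
  "sublevel_set L g = {(h, p). enn2ereal (L h p) \<le> ereal (g p)}"

definition sublevel_section :: "('h \<Rightarrow> 'p \<Rightarrow> ennreal) \<Rightarrow> ('p \<Rightarrow> real) \<Rightarrow> 'h \<Rightarrow> 'p set" where
  "sublevel_section L g h = {p. (h, p) \<in> sublevel_set L g}"

(* cond is a version of the conditional distribution of P given H. *)
definition sublevel_prob ::
  "('h \<Rightarrow> 'p measure) \<Rightarrow> ('h \<Rightarrow> 'p \<Rightarrow> ennreal) \<Rightarrow> ('p \<Rightarrow> real) \<Rightarrow> 'h \<Rightarrow> real" where
  "sublevel_prob cond L g h = measure (cond h) (sublevel_section L g h)"

(* \<mu> is the law of P. On the sublevel section the loss is at most g, so that enn2real does not lose
   the value \<infinity> here, and the integrand is dominated by the absolute value of g. *)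
definition sublevel_risk ::
  "'p measure \<Rightarrow> ('h \<Rightarrow> 'p measure) \<Rightarrow> ('h \<Rightarrow> 'p \<Rightarrow> ennreal) \<Rightarrow> ('p \<Rightarrow> real) \<Rightarrow> 'h \<Rightarrow> real" where
  "sublevel_risk \<mu> cond L g h =
     (if sublevel_prob cond L g h > 0
      then 1 / sublevel_prob cond L g h *
             (\<integral>p. enn2real (L h p) * indicator (sublevel_section L g h) p \<partial>\<mu>)
      else 0)"

definition emp_sublevel_risk ::
  "nat \<Rightarrow> ('h \<Rightarrow> 'p measure) \<Rightarrow> ('h \<Rightarrow> 'p \<Rightarrow> ennreal) \<Rightarrow> ('p \<Rightarrow> real) \<Rightarrow> 'h \<Rightarrow> (nat \<Rightarrow> 'p) \<Rightarrow> real" where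
  "emp_sublevel_risk N cond L g h d =
     1 / sublevel_prob cond L g h *
       (1 / real N * (\<Sum>i=1..N. indicator (sublevel_section L g h) (d i) * enn2real (L h (d i))))"

definition sublevel_moment ::
  "'p measure \<Rightarrow> ('h \<Rightarrow> 'p \<Rightarrow> ennreal) \<Rightarrow> ('p \<Rightarrow> real) \<Rightarrow> 'h \<Rightarrow> real" where
  "sublevel_moment \<mu> L g h = (\<integral>p. (g p)\<^sup>2 * indicator (sublevel_section L g h) p \<partial>\<mu>)"

definition nat_param :: "real \<Rightarrow> real \<times> real" where
  "nat_param \<gamma> = (\<gamma>, - \<gamma>\<^sup>2 / 2)"

definition suff_stat ::
  "nat \<Rightarrow> 'p measure \<Rightarrow> ('h \<Rightarrow> 'p measure) \<Rightarrow> ('h \<Rightarrow> 'p \<Rightarrow> ennreal) \<Rightarrow> ('p \<Rightarrow> real) \<Rightarrow>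
     'h \<Rightarrow> (nat \<Rightarrow> 'p) \<Rightarrow> real \<times> real" where
  "suff_stat N \<mu> cond L g h d =
     (sublevel_risk \<mu> cond L g h - emp_sublevel_risk N cond L g h d,
      1 / ((sublevel_prob cond L g h)\<^sup>2 * real N) * sublevel_moment \<mu> L g h)"

definition partition_fun ::
  "nat \<Rightarrow> 'p measure \<Rightarrow> 'h measure \<Rightarrow> ('h \<Rightarrow> 'p measure) \<Rightarrow> ('h \<Rightarrow> 'p \<Rightarrow> ennreal) \<Rightarrow> ('p \<Rightarrow> real) \<Rightarrow>
     real \<Rightarrow> (nat \<Rightarrow> 'p) \<Rightarrow> ennreal" where
  "partition_fun N \<mu> \<nu> cond L g \<gamma> d =
     (\<integral>\<^sup>+ h. ennreal (exp (nat_param \<gamma> \<bullet> suff_stat N \<mu> cond L g h d)) \<partial>\<nu>)"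

definition log_partition ::
  "nat \<Rightarrow> 'p measure \<Rightarrow> 'h measure \<Rightarrow> ('h \<Rightarrow> 'p measure) \<Rightarrow> ('h \<Rightarrow> 'p \<Rightarrow> ennreal) \<Rightarrow> ('p \<Rightarrow> real) \<Rightarrow>
     real \<Rightarrow> (nat \<Rightarrow> 'p) \<Rightarrow> real" where
  "log_partition N \<mu> \<nu> cond L g \<gamma> d = ln (enn2real (partition_fun N \<mu> \<nu> cond L g \<gamma> d))"

end

theory Submission
  imports Defs
begin

text \<open>
  For fixed \<open>h\<close> the summands of the empirical risk are i.i.d. and nonnegative, so the bound
  \<open>exp (- x) \<le> 1 - x + x\<^sup>2 / 2\<close> for \<open>x \<ge> 0\<close> controls their Laplace transform by the second moment
  alone, and \<open>\<E>\<^sub>D (exp \<langle>\<eta>(\<gamma>), T(h, D)\<rangle>) \<le> 1\<close>. By Fubini the partition function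
  has expectation at most 1 over \<open>D\<close> for each \<open>\<gamma>\<close>. Markov's inequality and a union bound over one
  representative \<open>\<gamma>\<^sub>i\<close> of each set of the covering give \<open>\<kappa>(\<gamma>\<^sub>i, D) \<le> ln (K / \<epsilon>)\<close> for all \<open>i\<close>, hence
  \<open>\<kappa>(\<gamma>, D) \<le> ln (K / \<epsilon>) + C\<close> for all \<open>\<gamma>\<close>. On this event the Donsker-Varadhan inequality yields
  the claim for all \<open>Q\<close> at once.
\<close>

section \<open>One-sided Laplace transform bounds for nonnegative variables\<close>

text \<open>Multiplying the right-hand side by the Taylor bound
  \<open>1 + x + x\<^sup>2 / 2 \<le> exp x\<close> gives \<open>1 + x ^ 4 / 4 \<ge> 1\<close>.
  Replacing that factor by \<open>exp x\<close> only enlarges the product, because the right-hand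
  side is nonnegative by completing the square.\<close>

lemma exp_minus_le_quadratic:
  fixes x :: real
  assumes "0 \<le> x"
  shows "exp (- x) \<le> 1 - x + x\<^sup>2 / 2"
proof -
  have "(1 - x + x\<^sup>2 / 2) * (1 + x + x\<^sup>2 / 2) = 1 + x ^ 4 / 4"
    by (simp add: field_simps power2_eq_square power4_eq_xxxx)
  then have "1 \<le> (1 - x + x\<^sup>2 / 2) * (1 + x + x\<^sup>2 / 2)"
    by simp
  also have "\<dots> \<le> (1 - x + x\<^sup>2 / 2) * exp x"
  proof (rule mult_left_mono)
    have "0 \<le> ((1 - x)\<^sup>2 + 1) / 2"
      by simp
    also have "\<dots> = 1 - x + x\<^sup>2 / 2"
      by (simp add: field_simps power2_eq_square)
    finally show "0 \<le> 1 - x + x\<^sup>2 / 2" .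
  qed (rule exp_lower_Taylor_quadratic[OF assms])
  finally show ?thesis
    by (simp add: exp_minus field_simps)
qed

text \<open>The quadratic bound is integrated at \<open>t * Y x\<close>, and
  \<open>1 + y \<le> exp y\<close> turns the result back into an exponential, the form that
  multiplies over independent coordinates.\<close>

lemma (in prob_space) nn_integral_exp_minus_le:
  fixes Y :: "'a \<Rightarrow> real"
  assumes Y[measurable]: "Y \<in> borel_measurable M"
    and nonneg: "\<And>x. 0 \<le> Y x"
    and sq: "integrable M (\<lambda>x. (Y x)\<^sup>2)"
    and "0 \<le> t"
  shows "(\<integral>\<^sup>+ x. ennreal (exp (- (t * Y x))) \<partial>M)
           \<le> ennreal (exp (- (t * expectation Y) + t\<^sup>2 / 2 * expectation (\<lambda>x. (Y x)\<^sup>2)))"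
proof -
  have int: "integrable M Y"
    using Y sq by (rule square_integrable_imp_integrable)
  have ie: "integrable M (\<lambda>x. exp (- (t * Y x)))"
    using \<open>0 \<le> t\<close> nonneg by (intro integrable_const_bound[where B=1]) auto
  have "(\<integral>\<^sup>+ x. ennreal (exp (- (t * Y x))) \<partial>M) = ennreal (expectation (\<lambda>x. exp (- (t * Y x))))"
    by (rule nn_integral_eq_integral[OF ie]) simp
  also have "expectation (\<lambda>x. exp (- (t * Y x)))
      \<le> expectation (\<lambda>x. 1 - t * Y x + t\<^sup>2 / 2 * (Y x)\<^sup>2)"
  proof (rule integral_mono[OF ie])
    show "integrable M (\<lambda>x. 1 - t * Y x + t\<^sup>2 / 2 * (Y x)\<^sup>2)"
      using int sq by simp
    show "exp (- (t * Y x)) \<le> 1 - t * Y x + t\<^sup>2 / 2 * (Y x)\<^sup>2" for x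
      using exp_minus_le_quadratic[of "t * Y x"] \<open>0 \<le> t\<close> nonneg[of x]
      by (simp add: power_mult_distrib)
  qed
  also have "\<dots> = 1 + (- (t * expectation Y) + t\<^sup>2 / 2 * expectation (\<lambda>x. (Y x)\<^sup>2))"
    using int sq by (simp add: prob_space)
  also have "\<dots> \<le> exp (- (t * expectation Y) + t\<^sup>2 / 2 * expectation (\<lambda>x. (Y x)\<^sup>2))"
    by (rule exp_ge_add_one_self)
  finally show ?thesis
    by (simp add: ennreal_leI)
qed

text \<open>The integrand is a product over the coordinates, so its integral is a product of
  one-dimensional integrals, each at most 1. The parameter \<open>m\<close> may be any bound on the
  second moment, which later lets the moment of \<open>g\<close> replace that of the loss.\<close>

lemma (in prob_space) nn_integral_exp_sample_deviation_le_1: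
  fixes Y :: "'a \<Rightarrow> real"
  assumes Y[measurable]: "Y \<in> borel_measurable M"
    and nonneg: "\<And>x. 0 \<le> Y x"
    and sq: "integrable M (\<lambda>x. (Y x)\<^sup>2)"
    and m: "expectation (\<lambda>x. (Y x)\<^sup>2) \<le> m"
    and I: "finite I" "I \<noteq> {}" and "0 \<le> \<gamma>"
  shows "(\<integral>\<^sup>+ d. ennreal (exp (\<gamma> * (expectation Y - (\<Sum>i\<in>I. Y (d i)) / card I)
             - \<gamma>\<^sup>2 / (2 * card I) * m)) \<partial>(\<Pi>\<^sub>M i\<in>I. M)) \<le> 1"
proof -
  interpret PS: product_prob_space "\<lambda>_. M" I
    by unfold_locales
  define n where "n = real (card I)"
  \<comment> \<open>The weight \<open>\<gamma>\<close> is shared equally among the \<open>n\<close>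
    coordinates. The constant \<open>c\<close> collects the deterministic part of one coordinate;
    \<open>n * (t\<^sup>2 / 2)\<close> recovers \<open>\<gamma>\<^sup>2 / (2 * n)\<close>.\<close>
  define t where "t = \<gamma> / n"
  define c where "c = exp (t * expectation Y - t\<^sup>2 / 2 * m)"
  have n: "n > 0"
    using I by (simp add: n_def card_gt_0_iff)
  then have "0 \<le> t"
    using \<open>0 \<le> \<gamma>\<close> by (simp add: t_def)
  have eq: "exp (\<gamma> * (expectation Y - (\<Sum>i\<in>I. Y (d i)) / card I) - \<gamma>\<^sup>2 / (2 * card I) * m)
      = (\<Prod>i\<in>I. c * exp (- (t * Y (d i))))" for d
  proof -
    have "(\<Prod>i\<in>I. c * exp (- (t * Y (d i))))
        = exp (\<Sum>i\<in>I. t * expectation Y - t\<^sup>2 / 2 * m + - (t * Y (d i)))"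
      using I by (simp add: exp_sum c_def exp_add[symmetric])
    also have "(\<Sum>i\<in>I. t * expectation Y - t\<^sup>2 / 2 * m + - (t * Y (d i)))
        = n * (t * expectation Y - t\<^sup>2 / 2 * m) - t * (\<Sum>i\<in>I. Y (d i))"
      by (simp add: sum.distrib sum_subtractf sum_distrib_left sum_negf n_def algebra_simps)
    also have "\<dots> = \<gamma> * (expectation Y - (\<Sum>i\<in>I. Y (d i)) / n) - \<gamma>\<^sup>2 / (2 * n) * m"
      using n by (simp add: t_def field_simps power2_eq_square)
    finally show ?thesis
      by (simp add: n_def)
  qed
  have "(\<integral>\<^sup>+ d. ennreal (exp (\<gamma> * (expectation Y - (\<Sum>i\<in>I. Y (d i)) / card I)
             - \<gamma>\<^sup>2 / (2 * card I) * m)) \<partial>(\<Pi>\<^sub>M i\<in>I. M))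
      = (\<integral>\<^sup>+ d. (\<Prod>i\<in>I. ennreal (c * exp (- (t * Y (d i))))) \<partial>(\<Pi>\<^sub>M i\<in>I. M))"
    unfolding eq by (subst prod_ennreal) (auto simp: c_def)
  also have "\<dots> = (\<Prod>i\<in>I. \<integral>\<^sup>+ x. ennreal (c * exp (- (t * Y x))) \<partial>M)"
    using I by (intro PS.product_nn_integral_prod) auto
  also have "\<dots> \<le> (\<Prod>i\<in>I. 1)"
  proof (rule prod_mono_ennreal)
    have "(\<integral>\<^sup>+ x. ennreal (c * exp (- (t * Y x))) \<partial>M)
        = ennreal c * (\<integral>\<^sup>+ x. ennreal (exp (- (t * Y x))) \<partial>M)"
      by (subst nn_integral_cmult[symmetric]) (auto simp: ennreal_mult c_def)
    also have "\<dots> \<le> ennreal c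
        * ennreal (exp (- (t * expectation Y) + t\<^sup>2 / 2 * expectation (\<lambda>x. (Y x)\<^sup>2)))"
      using nn_integral_exp_minus_le[OF Y nonneg sq \<open>0 \<le> t\<close>] by (rule mult_left_mono) simp
    also have "\<dots> = ennreal (exp (t\<^sup>2 / 2 * (expectation (\<lambda>x. (Y x)\<^sup>2) - m)))"
      by (simp add: c_def ennreal_mult[symmetric] exp_add[symmetric] algebra_simps)
    also have "\<dots> \<le> 1"
      using m by (simp add: mult_nonneg_nonpos)
    finally show "(\<integral>\<^sup>+ x. ennreal (c * exp (- (t * Y x))) \<partial>M) \<le> 1" .
  qed
  finally show ?thesis
    by simp
qed

section \<open>Calculus of integrals with values in the extended reals\<close>

lemma ext_integral_nonneg:
  assumes "\<And>x. 0 \<le> f x"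
  shows "ext_integral Q f = enn2ereal (\<integral>\<^sup>+ x. ennreal (f x) \<partial>Q)"
proof -
  have "(\<integral>\<^sup>+ x. ennreal (- f x) \<partial>Q) = 0"
    using assms by (simp add: ennreal_neg)
  then show ?thesis
    by (simp add: ext_integral_def zero_ennreal.rep_eq)
qed

lemma ext_integral_integrable:
  assumes f: "integrable Q f"
  shows "ext_integral Q f = ereal (\<integral>x. f x \<partial>Q)"
proof -
  have "(\<integral>\<^sup>+ x. ennreal (f x) \<partial>Q) \<noteq> \<infinity>" "(\<integral>\<^sup>+ x. ennreal (- f x) \<partial>Q) \<noteq> \<infinity>"
    using f by (auto elim: integrableE)
  then show ?thesis
    unfolding ext_integral_def real_lebesgue_integral_def[OF f]
    by (cases "\<integral>\<^sup>+ x. ennreal (f x) \<partial>Q"; cases "\<integral>\<^sup>+ x. ennreal (- f x) \<partial>Q") auto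
qed

lemma ext_integral_nonneg_finite:
  assumes [measurable]: "f \<in> borel_measurable Q"
    and nonneg: "\<And>x. 0 \<le> f x" and fin: "ext_integral Q f \<noteq> \<infinity>"
  shows "integrable Q f"
proof (rule integrableI_nonneg)
  show "(\<integral>\<^sup>+ x. ennreal (f x) \<partial>Q) < \<infinity>"
    using fin unfolding ext_integral_nonneg[OF nonneg]
    by (metis enn2ereal_eq_top_iff infinity_ennreal_def top.not_eq_extremum)
qed (use nonneg in auto)

lemma ext_integral_add_nonneg:
  assumes "f \<in> borel_measurable Q" "g \<in> borel_measurable Q"
    and "\<And>x. 0 \<le> f x" "\<And>x. 0 \<le> g x"
  shows "ext_integral Q (\<lambda>x. f x + g x) = ext_integral Q f + ext_integral Q g"
  using assms by (simp add: ext_integral_nonneg nn_integral_add plus_ennreal.rep_eq)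

lemma ext_integral_cmult_nonneg:
  assumes "f \<in> borel_measurable Q" "\<And>x. 0 \<le> f x" "0 \<le> c"
  shows "ext_integral Q (\<lambda>x. c * f x) = ereal c * ext_integral Q f"
  using assms
  by (simp add: ext_integral_nonneg ennreal_mult nn_integral_cmult times_ennreal.rep_eq)


section \<open>Relative entropy and the change of measure\<close>

text \<open>The factor \<open>f x\<close> cancels where it is positive. Where it is 0 the left-hand
  side contributes nothing, so only an inequality holds in general.\<close>

lemma nn_integral_divide_density_le:
  fixes f u :: "'a \<Rightarrow> real"
  assumes [measurable]: "f \<in> borel_measurable \<mu>" "u \<in> borel_measurable \<mu>"
    and "\<And>x. 0 \<le> f x" "\<And>x. 0 \<le> u x"
  shows "(\<integral>\<^sup>+ x. ennreal (u x / f x) \<partial>density \<mu> (\<lambda>x. ennreal (f x))) \<le> (\<integral>\<^sup>+ x. ennreal (u x) \<partial>\<mu>)"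
proof -
  have "(\<integral>\<^sup>+ x. ennreal (u x / f x) \<partial>density \<mu> (\<lambda>x. ennreal (f x)))
      = (\<integral>\<^sup>+ x. ennreal (f x) * ennreal (u x / f x) \<partial>\<mu>)"
    by (rule nn_integral_density) auto
  also have "\<dots> \<le> (\<integral>\<^sup>+ x. ennreal (u x) \<partial>\<mu>)"
    using assms(3,4) by (intro nn_integral_mono) (simp add: ennreal_mult[symmetric])
  finally show ?thesis .
qed

text \<open>Provides a real-valued density together with the fact that the negative part of its
  logarithm has finite integral, so the divergence is never a difference of two infinities.\<close>

lemma KL_div_density:
  assumes \<mu>: "prob_space \<mu>" and Q: "prob_space Q"
    and ac: "absolutely_continuous \<mu> Q" and sets: "sets Q = sets \<mu>"
  obtains f where "f \<in> borel_measurable \<mu>" "\<And>x. 0 \<le> f x"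
    "Q = density \<mu> (\<lambda>x. ennreal (f x))" "AE x in Q. 0 < f x"
    "KL_div Q \<mu> = ext_integral Q (\<lambda>x. ln (f x))"
    "(\<integral>\<^sup>+ x. ennreal (- ln (f x)) \<partial>Q) < \<infinity>"
proof -
  interpret \<mu>: prob_space \<mu> by fact
  interpret Q: prob_space Q by fact
  \<comment> \<open>This is the version of the derivative inside \<open>entropy_density\<close>, so
    \<open>KL_div\<close> unfolds to the integral of \<open>ln (f x)\<close>. It represents
    \<open>Q\<close> because the derivative is finite almost everywhere.\<close>
  define f where "f x = enn2real (RN_deriv \<mu> Q x)" for x
  have f[measurable]: "f \<in> borel_measurable \<mu>" and f0: "\<And>x. 0 \<le> f x"
    by (auto simp: f_def[abs_def])
  have "Q = density \<mu> (RN_deriv \<mu> Q)"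
    using \<mu>.density_RN_deriv[OF ac sets] by simp
  also have "\<dots> = density \<mu> (\<lambda>x. ennreal (f x))"
    using \<mu>.RN_deriv_finite[OF Q.sigma_finite_measure_axioms ac sets]
    by (intro density_cong) (auto simp: f_def less_top)
  finally have Q_eq: "Q = density \<mu> (\<lambda>x. ennreal (f x))" .
  have pos: "AE x in Q. 0 < f x"
    by (subst Q_eq, subst AE_density) auto
  have KL: "KL_div Q \<mu> = ext_integral Q (\<lambda>x. ln (f x))"
    using ac by (simp add: KL_div_def entropy_density_def comp_def f_def log_def)
  \<comment> \<open>The negative part of the logarithm is dominated by \<open>1 / f\<close>, whose
    \<open>Q\<close>-integral is at most the total mass of \<open>\<mu>\<close>.\<close>
  have "(\<integral>\<^sup>+ x. ennreal (- ln (f x)) \<partial>Q) \<le> (\<integral>\<^sup>+ x. ennreal (1 / f x) \<partial>Q)"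
  proof (rule nn_integral_mono_AE, use pos in eventually_elim)
    fix x assume "0 < f x"
    then have "- ln (f x) \<le> 1 / f x"
      using ln_le_minus_one[of "1 / f x"] by (simp add: ln_div)
    then show "ennreal (- ln (f x)) \<le> ennreal (1 / f x)"
      by (rule ennreal_leI)
  qed
  also have "\<dots> \<le> (\<integral>\<^sup>+ x. ennreal 1 \<partial>\<mu>)"
    by (subst Q_eq, rule nn_integral_divide_density_le) (auto simp: f0)
  also have "\<dots> < \<infinity>"
    by (simp add: \<mu>.emeasure_space_1)
  finally have neg: "(\<integral>\<^sup>+ x. ennreal (- ln (f x)) \<partial>Q) < \<infinity>" .
  show thesis
    by (rule that[OF f f0 Q_eq pos KL neg])
qed

lemma KL_div_not_MInf:
  assumes "prob_space \<mu>" "prob_space Q" "absolutely_continuous \<mu> Q" "sets Q = sets \<mu>"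
  shows "KL_div Q \<mu> \<noteq> - \<infinity>"
proof -
  obtain f where KL: "KL_div Q \<mu> = ext_integral Q (\<lambda>x. ln (f x))"
    and neg: "(\<integral>\<^sup>+ x. ennreal (- ln (f x)) \<partial>Q) < \<infinity>"
    using KL_div_density[OF assms] by metis
  show ?thesis
    using neg unfolding KL ext_integral_def
    by (cases "\<integral>\<^sup>+ x. ennreal (ln (f x)) \<partial>Q"; cases "\<integral>\<^sup>+ x. ennreal (- ln (f x)) \<partial>Q")
      (auto simp: top_ennreal.rep_eq)
qed

text \<open>
  Stated with \<open>b\<close> moved to the right-hand side, since \<open>a\<close> and \<open>b\<close> may both have infinite
  \<open>Q\<close>-integral, in which case the integral of \<open>a - b\<close> would be undefined.
\<close>
lemma Donsker_Varadhan:
  fixes a b :: "'a \<Rightarrow> real"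
  assumes \<mu>: "prob_space \<mu>" and Q: "prob_space Q"
    and ac: "absolutely_continuous \<mu> Q" and sets: "sets Q = sets \<mu>"
    and a[measurable]: "a \<in> borel_measurable \<mu>" and b[measurable]: "b \<in> borel_measurable \<mu>"
    and a0: "\<And>x. 0 \<le> a x" and b0: "\<And>x. 0 \<le> b x"
    and z: "(\<integral>\<^sup>+ x. ennreal (exp (a x - b x)) \<partial>\<mu>) = ennreal z" "0 < z"
  shows "ext_integral Q a \<le> KL_div Q \<mu> + ereal (ln z) + ext_integral Q b"
proof -
  interpret Q: prob_space Q by fact
  have meas: "h \<in> borel_measurable Q" if "h \<in> borel_measurable \<mu>" for h :: "'a \<Rightarrow> real"
    using that measurable_cong_sets[OF sets refl] by blast
  obtain f where f[measurable]: "f \<in> borel_measurable \<mu>" and f0: "\<And>x. 0 \<le> f x"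
    and Q_eq: "Q = density \<mu> (\<lambda>x. ennreal (f x))" and pos: "AE x in Q. 0 < f x"
    and KL: "KL_div Q \<mu> = ext_integral Q (\<lambda>x. ln (f x))"
    and neg_fin: "(\<integral>\<^sup>+ x. ennreal (- ln (f x)) \<partial>Q) < \<infinity>"
    using KL_div_density[OF \<mu> Q ac sets] by blast
  have KL_mi: "KL_div Q \<mu> \<noteq> - \<infinity>"
    by (rule KL_div_not_MInf[OF \<mu> Q ac sets])
  have b_mi: "ext_integral Q b \<noteq> - \<infinity>"
    using enn2ereal_nonneg[of "\<integral>\<^sup>+ x. ennreal (b x) \<partial>Q"]
    by (auto simp: ext_integral_nonneg[OF b0] simp del: enn2ereal_nonneg)
  show ?thesis
  proof (cases "KL_div Q \<mu> = \<infinity> \<or> ext_integral Q b = \<infinity>")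
    case True
    with KL_mi b_mi have "KL_div Q \<mu> + ereal (ln z) + ext_integral Q b = \<infinity>"
      by (cases "KL_div Q \<mu>"; cases "ext_integral Q b") auto
    then show ?thesis
      by (metis ereal_less_eq(1))
  next
    case False
    have ib: "integrable Q b"
      using False b0 by (intro ext_integral_nonneg_finite meas b) auto
    have if': "integrable Q (\<lambda>x. ln (f x))"
    proof (rule integrableI_bounded)
      have "(\<integral>\<^sup>+ x. ennreal (ln (f x)) \<partial>Q) < \<infinity>"
        using False neg_fin unfolding KL ext_integral_def
        by (cases "\<integral>\<^sup>+ x. ennreal (ln (f x)) \<partial>Q"; cases "\<integral>\<^sup>+ x. ennreal (- ln (f x)) \<partial>Q")
          (auto simp: top_ennreal.rep_eq)
      moreover have "(\<integral>\<^sup>+ x. ennreal (norm (ln (f x))) \<partial>Q)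
          = (\<integral>\<^sup>+ x. ennreal (ln (f x)) + ennreal (- ln (f x)) \<partial>Q)"
        by (intro nn_integral_cong) (auto simp: abs_real_def ennreal_neg)
      moreover have "\<dots> = (\<integral>\<^sup>+ x. ennreal (ln (f x)) \<partial>Q) + (\<integral>\<^sup>+ x. ennreal (- ln (f x)) \<partial>Q)"
        by (rule nn_integral_add) (auto intro!: measurable_compose[OF meas])
      ultimately show "(\<integral>\<^sup>+ x. ennreal (norm (ln (f x))) \<partial>Q) < \<infinity>"
        using neg_fin by simp
    qed (auto intro: meas)
    \<comment> \<open>Up to the factor \<open>z\<close>, this is the likelihood ratio of the Gibbs
      measure with \<open>\<mu>\<close>-density \<open>exp (a x - b x) / z\<close> against
      \<open>Q\<close>, where \<open>f\<close> is positive.\<close>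
    define u where "u x = exp (a x - b x) / f x" for x
    have u_le: "(\<integral>\<^sup>+ x. ennreal (u x) \<partial>Q) \<le> ennreal z"
      unfolding u_def z(1)[symmetric]
      by (subst Q_eq, rule nn_integral_divide_density_le) (auto simp: f0)
    have iu: "integrable Q u"
      by (rule integrableI_nonneg)
        (use u_le in \<open>auto intro!: meas simp: u_def[abs_def] f0 intro: le_less_trans\<close>)
    have u0: "0 \<le> u x" for x
      by (simp add: u_def f0)
    have u_int: "(\<integral>x. u x \<partial>Q) \<le> z"
      using u_le iu z(2) u0 by (simp add: nn_integral_eq_integral)
    \<comment> \<open>The pointwise bound \<open>ln y \<le> y - 1\<close> at
      \<open>y = u x / z\<close> takes the place of Jensen's inequality. It also yields an
      integrable majorant of \<open>a\<close>, from which the integrability of \<open>a\<close>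
      follows.\<close>
    let ?r = "\<lambda>x. u x / z - 1 + ln (f x) + ln z + b x"
    have ir: "integrable Q ?r"
      using iu if' ib by simp
    have le: "AE x in Q. a x \<le> ?r x"
      using pos
    proof eventually_elim
      fix x assume "0 < f x"
      then have "ln (u x / z) = a x - b x - ln (f x) - ln z"
        using z(2) by (simp add: u_def ln_div ln_mult)
      moreover have "ln (u x / z) \<le> u x / z - 1"
        using \<open>0 < f x\<close> z(2) by (intro ln_le_minus_one) (simp add: u_def)
      ultimately show "a x \<le> ?r x"
        by simp
    qed
    have ia: "integrable Q a"
      by (rule Bochner_Integration.integrable_bound[OF ir meas[OF a]])
        (use le a0 in \<open>auto elim!: eventually_mono\<close>)
    have "(\<integral>x. a x \<partial>Q) \<le> (\<integral>x. ?r x \<partial>Q)"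
      by (rule integral_mono_AE[OF ia ir le])
    also have "\<dots> = (\<integral>x. u x \<partial>Q) / z - 1 + (\<integral>x. ln (f x) \<partial>Q) + ln z + (\<integral>x. b x \<partial>Q)"
      using iu if' ib by (simp add: Q.prob_space)
    also have "\<dots> \<le> (\<integral>x. ln (f x) \<partial>Q) + ln z + (\<integral>x. b x \<partial>Q)"
      using u_int z(2) by simp
    finally show ?thesis
      unfolding KL ext_integral_integrable[OF ia] ext_integral_integrable[OF ib]
        ext_integral_integrable[OF if'] by simp
  qed
qed

text \<open>Division by \<open>\<gamma>\<close> in the extended reals: an infinite term on the right
  makes the claim trivial, and otherwise everything, including \<open>R\<close>, is a real
  number.\<close>

lemma PAC_Bayes_rearrange:
  fixes R E S KL :: ereal
  assumes "0 < \<gamma>" "0 < w" "0 \<le> R" "0 \<le> E" "0 \<le> S" "KL \<noteq> - \<infinity>" "c \<le> c1 + c2"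
    and le: "ereal \<gamma> * R \<le> KL + ereal c + (ereal \<gamma> * E + ereal (\<gamma> * w) * S)"
  shows "R \<le> E + (KL + ereal c1 + ereal c2) / ereal \<gamma> + ereal w * S"
proof (cases "KL = \<infinity> \<or> E = \<infinity> \<or> S = \<infinity>")
  case True
  have "E + (KL + ereal c1 + ereal c2) / ereal \<gamma> + ereal w * S = \<infinity>"
    using True assms by (cases KL; cases E; cases S) auto
  then show ?thesis
    by (metis ereal_less_eq(1))
next
  case False
  then obtain k e s where KES: "KL = ereal k" "E = ereal e" "S = ereal s"
    using assms by (cases KL; cases E; cases S) auto
  have "ereal \<gamma> * R \<le> ereal (k + c + (\<gamma> * e + \<gamma> * w * s))"
    using le by (simp add: KES)
  then obtain r where r: "R = ereal r" "\<gamma> * r \<le> k + c + (\<gamma> * e + \<gamma> * w * s)"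
    using assms by (cases R) auto
  have "\<gamma> * (e + (k + c1 + c2) / \<gamma> + w * s) = k + c1 + c2 + (\<gamma> * e + \<gamma> * w * s)"
    using \<open>0 < \<gamma>\<close> by (simp add: field_simps)
  then have "\<gamma> * r \<le> \<gamma> * (e + (k + c1 + c2) / \<gamma> + w * s)"
    using r(2) \<open>c \<le> c1 + c2\<close> by linarith
  then have "r \<le> e + (k + c1 + c2) / \<gamma> + w * s"
    using assms by (simp only: mult_le_cancel_left_pos)
  then show ?thesis
    using \<open>0 < \<gamma>\<close> by (simp add: KES r)
qed

theorem theorem1:
  fixes M :: "'w measure"
    and P :: "'w \<Rightarrow> 'p :: polish_space" and Ps :: "nat \<Rightarrow> 'w \<Rightarrow> 'p"
    and D :: "'w \<Rightarrow> nat \<Rightarrow> 'p" and N :: nat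
    and H :: "'w \<Rightarrow> 'h :: polish_space"
    and l :: "(real ^ 'n) \<times> 'p \<Rightarrow> ennreal"
    and A :: "'h \<times> (real ^ 'n) \<times> 'p \<Rightarrow> real ^ 'n"
    and x0 :: "real ^ 'n"
    and g :: "'p \<Rightarrow> real"
    and L :: "'h \<Rightarrow> 'p \<Rightarrow> ennreal"
    and \<mu>P :: "'p measure" and \<mu>H :: "'h measure"
    and cond :: "'h \<Rightarrow> 'p measure"
    and \<Gamma> :: "real set" and K :: nat and \<O> :: "nat \<Rightarrow> real set" and C :: real
    and \<epsilon> :: real
  assumes "prob_space M"
    and "l \<in> borel_measurable (borel \<Otimes>\<^sub>M borel)"
    and "A \<in> borel_measurable (borel \<Otimes>\<^sub>M borel \<Otimes>\<^sub>M borel)"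
    and "L = loss l A x0"
    and "N \<ge> 1"
    and "prob_space.indep_vars M (\<lambda>_. borel) (\<lambda>i. if i = 0 then P else Ps i) {0..N}"
    and "\<And>i. i \<in> {1..N} \<Longrightarrow> distr M borel (Ps i) = distr M borel P"
    and "D = (\<lambda>\<omega>. \<lambda>i\<in>{1..N}. Ps i \<omega>)"
    and "indep_rv M borel H (\<Pi>\<^sub>M i\<in>{1..N}. borel) D"
    and "indep_rv M borel H borel P"
    and "\<mu>P = distr M borel P"
    and "\<mu>H = distr M borel H"
    and "g \<in> borel_measurable borel"
    and "integrable \<mu>P (\<lambda>p. (g p)\<^sup>2)"
    and "regular_cond_distr M borel P borel H cond"
    and "measure \<mu>H {h. sublevel_prob cond L g h > 0} = 1"
    and "\<Gamma> \<subseteq> {0<..}" and "compact \<Gamma>"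
    and "\<And>\<gamma> d. \<gamma> \<in> \<Gamma> \<Longrightarrow> d \<in> {1..N} \<rightarrow>\<^sub>E UNIV \<Longrightarrow>
           partition_fun N \<mu>P \<mu>H cond L g \<gamma> d \<in> {0<..<\<infinity>}"
    and "(\<Union>i\<in>{1..K}. \<O> i) = \<Gamma>"
    and "\<And>d. d \<in> {1..N} \<rightarrow>\<^sub>E UNIV \<Longrightarrow>
           (MAX i\<in>{1..K}. SUP (\<gamma>, \<gamma>') \<in> \<O> i \<times> \<O> i.
              ereal (log_partition N \<mu>P \<mu>H cond L g \<gamma> d - log_partition N \<mu>P \<mu>H cond L g \<gamma>' d))
           \<le> ereal C"
    and "\<epsilon> > 0"
  shows "\<exists>B\<in>sets (\<Pi>\<^sub>M i\<in>{1..N}. borel).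
           measure M {\<omega> \<in> space M. D \<omega> \<in> B} \<ge> 1 - \<epsilon> \<and>
           (\<forall>d\<in>B. \<forall>\<gamma>\<in>\<Gamma>. \<forall>Q. prob_space Q \<and> sets Q = sets borel \<and> absolutely_continuous \<mu>H Q \<longrightarrow>
              ext_integral Q (sublevel_risk \<mu>P cond L g)
              \<le> ext_integral Q (\<lambda>h. emp_sublevel_risk N cond L g h d)
                + (KL_div Q \<mu>H + ereal (ln (real K / \<epsilon>)) + ereal C) / ereal \<gamma>
                + ereal (\<gamma> / (2 * real N))
                    * ext_integral Q (\<lambda>h. sublevel_moment \<mu>P L g h / (sublevel_prob cond L g h)\<^sup>2))"
proof -
  note l = assms(2) and A = assms(3) and L_eq = assms(4) and N = assms(5) and indep = assms(6)
    and same_law = assms(7) and D_eq = assms(8) and \<mu>P_eq = assms(11) and \<mu>H_eq = assms(12)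
    and g = assms(13) and g2 = assms(14) and rcd = assms(15)
    and \<Gamma>_pos = assms(17) and part_fin = assms(19) and cover = assms(20) and osc = assms(21)
    and \<epsilon> = assms(22)
  note l[measurable] A[measurable] g[measurable]
  interpret prob_space M by (rule assms(1))

  \<comment> \<open>The laws of the random variables and of the sample\<close>
  have P[measurable]: "P \<in> M \<rightarrow>\<^sub>M borel" and H[measurable]: "H \<in> M \<rightarrow>\<^sub>M borel"
    and D[measurable]: "D \<in> M \<rightarrow>\<^sub>M (\<Pi>\<^sub>M i\<in>{1..N}. borel)"
    using assms(9,10) by (auto simp: indep_rv_def)
  interpret \<mu>P: prob_space \<mu>P
    unfolding \<mu>P_eq by (rule prob_space_distr) simp
  interpret \<mu>H: prob_space \<mu>H
    unfolding \<mu>H_eq by (rule prob_space_distr) simp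
  have [measurable_cong]: "sets \<mu>P = sets borel" "sets \<mu>H = sets borel"
    by (simp_all add: \<mu>P_eq \<mu>H_eq)
  define PN where "PN = (\<Pi>\<^sub>M i\<in>{1..N}. \<mu>P)"
  interpret PN: prob_space PN
    unfolding PN_def by (rule prob_space_PiM) (rule \<mu>P.prob_space_axioms)
  have sets_PN[measurable_cong]: "sets PN = sets (\<Pi>\<^sub>M i\<in>{1..N}. borel)"
    unfolding PN_def by (rule sets_PiM_cong) (simp_all add: \<mu>P_eq)
  have D_law: "distr M (\<Pi>\<^sub>M i\<in>{1..N}. borel) D = PN"
  proof -
    \<comment> \<open>Index 0 of the joint family carries \<open>P\<close>; restricting to
      \<open>{1..N}\<close> leaves exactly the sample.\<close>
    have "indep_vars (\<lambda>_. borel) (\<lambda>i. if i = 0 then P else Ps i) {1..N}"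
      by (rule indep_vars_subset[OF indep]) auto
    then have ind: "indep_vars (\<lambda>_. borel) Ps {1..N}"
      by (rule indep_vars_cong[THEN iffD1, rotated -1]) auto
    have "distr M (\<Pi>\<^sub>M i\<in>{1..N}. borel) D = (\<Pi>\<^sub>M i\<in>{1..N}. distr M borel (Ps i))"
      unfolding D_eq using N ind
      by (subst indep_vars_iff_distr_eq_PiM'[symmetric]) (auto simp: indep_vars_def)
    also have "\<dots> = PN"
      unfolding PN_def \<mu>P_eq by (rule PiM_cong) (use same_law in auto)
    finally show ?thesis .
  qed

  \<comment> \<open>Measurability, signs and domination of the sublevel quantities\<close>
  define S where "S = sublevel_set L g"
  define \<pi> where "\<pi> = sublevel_prob cond L g"
  \<comment> \<open>Truncating the loss to the sublevel section keeps it between 0 and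
    \<open>g\<close> there, so it inherits square integrability from \<open>g\<close>.\<close>
  define Y where "Y h p = enn2real (L h p) * indicator (sublevel_section L g h) p" for h p
  define m where "m = sublevel_moment \<mu>P L g"
  define R where "R = sublevel_risk \<mu>P cond L g"
  define E where "E h d = emp_sublevel_risk N cond L g h d" for h d
  define Z where "Z \<gamma> d = partition_fun N \<mu>P \<mu>H cond L g \<gamma> d" for \<gamma> d
  have L[measurable]: "(\<lambda>(h, p). L h p) \<in> borel_measurable (borel \<Otimes>\<^sub>M borel)"
    unfolding L_eq loss_def by measurable
  have S[measurable]: "S \<in> sets (borel \<Otimes>\<^sub>M borel)"
  proof -
    have "{x \<in> space (borel \<Otimes>\<^sub>M borel).
        enn2ereal (case x of (h, p) \<Rightarrow> L h p) \<le> ereal (g (snd x))} \<in> sets (borel \<Otimes>\<^sub>M borel)"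
      by measurable
    then show ?thesis
      by (simp add: S_def sublevel_set_def space_pair_measure split_beta')
  qed
  \<comment> \<open>Passing from sections to the joint set \<open>S\<close> gives measurability in
    \<open>h\<close> and \<open>p\<close> together.\<close>
  have sec: "indicator (sublevel_section L g h) p = (indicator S (h, p) :: real)" for h p
    by (simp add: S_def sublevel_section_def indicator_def)
  have \<pi>[measurable]: "\<pi> \<in> borel_measurable borel"
  proof -
    have "Sigma (space borel) (sublevel_section L g) = S"
      by (auto simp: S_def sublevel_section_def)
    then show ?thesis
      unfolding \<pi>_def sublevel_prob_def using rcd
      by (intro measure_measurable_prob_algebra2[where N=borel])
        (auto simp: regular_cond_distr_def)
  qed
  have \<pi>0: "0 \<le> \<pi> h" for h
    by (simp add: \<pi>_def sublevel_prob_def)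
  have Y[measurable]: "(\<lambda>(h, p). Y h p) \<in> borel_measurable (borel \<Otimes>\<^sub>M borel)"
    unfolding Y_def sec by measurable
  have Y0: "0 \<le> Y h p" for h p
    by (simp add: Y_def)
  have Y_le: "(Y h p)\<^sup>2 \<le> (g p)\<^sup>2 * indicator (sublevel_section L g h) p" for h p
  proof (cases "p \<in> sublevel_section L g h")
    case True
    then have "enn2ereal (L h p) \<le> ereal (g p)"
      by (simp add: sublevel_section_def sublevel_set_def)
    then have "enn2real (L h p) \<le> g p"
      by (cases "L h p") (auto simp: top_ennreal.rep_eq)
    then show ?thesis
      using True by (simp add: Y_def power_mono)
  qed (simp add: Y_def)
  have m_int: "integrable \<mu>P (\<lambda>p. (g p)\<^sup>2 * indicator (sublevel_section L g h) p)" for h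
    unfolding sec by (rule Bochner_Integration.integrable_bound[OF g2]) (auto simp: indicator_def)
  have Y2_int: "integrable \<mu>P (\<lambda>p. (Y h p)\<^sup>2)" for h
    by (rule Bochner_Integration.integrable_bound[OF m_int[of h]]) (use Y_le in auto)
  have m_eq: "m h = (\<integral>p. (g p)\<^sup>2 * indicator (sublevel_section L g h) p \<partial>\<mu>P)" for h
    by (simp add: m_def sublevel_moment_def)
  have Y2_le: "(\<integral>p. (Y h p)\<^sup>2 \<partial>\<mu>P) \<le> m h" for h
    unfolding m_eq by (rule integral_mono[OF Y2_int m_int]) (rule Y_le)
  have m[measurable]: "m \<in> borel_measurable borel"
    unfolding m_eq[abs_def] sec by measurable
  have m0: "0 \<le> m h" for h
    unfolding m_eq by (rule Bochner_Integration.integral_nonneg) simp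
  \<comment> \<open>The case distinction in the definition agrees with the convention \<open>1 / 0 = 0\<close>.\<close>
  have R_eq: "R h = 1 / \<pi> h * (\<integral>p. Y h p \<partial>\<mu>P)" for h
    using \<pi>0[of h] by (simp add: R_def sublevel_risk_def Y_def \<pi>_def)
  have R[measurable]: "R \<in> borel_measurable borel"
    unfolding R_eq[abs_def] by measurable
  have R0: "0 \<le> R h" for h
    unfolding R_eq using \<pi>0 Y0 by (intro mult_nonneg_nonneg Bochner_Integration.integral_nonneg) auto
  have E_eq: "E h d = 1 / \<pi> h * ((\<Sum>i\<in>{1..N}. Y h (d i)) / N)" for h d
    by (simp add: E_def emp_sublevel_risk_def Y_def \<pi>_def mult.commute)
  have E[measurable]: "(\<lambda>(h, d). E h d) \<in> borel_measurable (borel \<Otimes>\<^sub>M PN)"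
    unfolding E_eq by measurable
  have E0: "0 \<le> E h d" for h d
    unfolding E_eq using \<pi>0 Y0 by (intro mult_nonneg_nonneg divide_nonneg_nonneg sum_nonneg) auto
  have Z_eq: "Z \<gamma> d
      = (\<integral>\<^sup>+ h. ennreal (exp (\<gamma> * (R h - E h d) - \<gamma>\<^sup>2 / (2 * N) * (m h / (\<pi> h)\<^sup>2))) \<partial>\<mu>H)" for \<gamma> d
    by (simp add: Z_def partition_fun_def nat_param_def suff_stat_def inner_Pair
        R_def E_def m_def \<pi>_def mult_ac)
  have Z[measurable]: "Z \<gamma> \<in> borel_measurable PN" for \<gamma>
    unfolding Z_eq[abs_def] by measurable

  \<comment> \<open>The expected partition function\<close>
  have Z_le: "(\<integral>\<^sup>+ d. Z \<gamma> d \<partial>PN) \<le> 1" if "0 \<le> \<gamma>" for \<gamma>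
  proof -
    interpret HP: pair_sigma_finite \<mu>H PN
      by unfold_locales
    let ?F = "\<lambda>h d. ennreal (exp (\<gamma> * (R h - E h d) - \<gamma>\<^sup>2 / (2 * N) * (m h / (\<pi> h)\<^sup>2)))"
    have "(\<integral>\<^sup>+ d. Z \<gamma> d \<partial>PN) = (\<integral>\<^sup>+ h. \<integral>\<^sup>+ d. ?F h d \<partial>PN \<partial>\<mu>H)"
      unfolding Z_eq by (rule HP.Fubini') measurable
    also have "\<dots> \<le> (\<integral>\<^sup>+ h. 1 \<partial>\<mu>H)"
    proof (rule nn_integral_mono)
      fix h
      \<comment> \<open>The rescaled variable has mean \<open>R h\<close>, sample mean
        \<open>E h d\<close> and second moment at most \<open>m h / (\<pi> h)\<^sup>2\<close>. If
        \<open>\<pi> h = 0\<close>, all of these are 0 by the convention for division, and the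
        integrand is constantly 1.\<close>
      let ?Y = "\<lambda>p. 1 / \<pi> h * Y h p"
      have "(\<integral>p. (?Y p)\<^sup>2 \<partial>\<mu>P) = (1 / \<pi> h)\<^sup>2 * (\<integral>p. (Y h p)\<^sup>2 \<partial>\<mu>P)"
        by (simp add: power_mult_distrib power_divide)
      also have "\<dots> \<le> (1 / \<pi> h)\<^sup>2 * m h"
        using Y2_le by (rule mult_left_mono) simp
      finally have Y2: "(\<integral>p. (?Y p)\<^sup>2 \<partial>\<mu>P) \<le> m h / (\<pi> h)\<^sup>2"
        by (simp add: power_divide)
      have "integrable \<mu>P (\<lambda>p. (?Y p)\<^sup>2)"
        using Y2_int[of h] by (simp add: power_mult_distrib power_divide)
      from \<mu>P.nn_integral_exp_sample_deviation_le_1[OF _ _ this Y2, of "{1..N}" \<gamma>]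
      show "(\<integral>\<^sup>+ d. ?F h d \<partial>PN) \<le> 1"
        using N that \<pi>0 Y0
        by (simp add: PN_def R_eq E_eq sum_divide_distrib mult.commute)
    qed
    finally show ?thesis
      by (simp add: \<mu>H.emeasure_space_1)
  qed

  \<comment> \<open>The good event, by Markov's inequality and a union bound\<close>
  show ?thesis
  proof (cases "\<epsilon> \<ge> 1")
    \<comment> \<open>The required probability \<open>1 - \<epsilon>\<close> is at most 0, so the
      empty event suffices.\<close>
    case True
    then show ?thesis
      by (intro bexI[of _ "{}"]) auto
  next
    case False
    \<comment> \<open>Only nonempty sets of the covering have a representative.\<close>
    define I where "I = {i \<in> {1..K}. \<O> i \<noteq> {}}"
    define \<gamma>0 where "\<gamma>0 i = (SOME \<gamma>. \<gamma> \<in> \<O> i)" for i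
    have \<gamma>0: "\<gamma>0 i \<in> \<O> i" if "i \<in> I" for i
      using that by (auto simp: I_def \<gamma>0_def some_in_eq)
    have \<gamma>0_\<Gamma>: "\<gamma>0 i \<in> \<Gamma>" if "i \<in> I" for i
      using \<gamma>0[OF that] that cover by (auto simp: I_def)
    \<comment> \<open>For \<open>i \<in> I\<close>, where \<open>K > 0\<close>, this says
      \<open>Z (\<gamma>0 i) d \<ge> K / \<epsilon>\<close>, in the form of Markov's inequality.
      Each representative thus receives the share \<open>\<epsilon> / K\<close> of the failure
      probability.\<close>
    define bad where "bad i = {d \<in> space PN. 1 \<le> ennreal (\<epsilon> / K) * Z (\<gamma>0 i) d}" for i
    have bad[measurable]: "bad i \<in> sets PN" for i
      unfolding bad_def by measurable
    have bad_le: "measure PN (bad i) \<le> \<epsilon> / K" if "i \<in> I" for i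
    proof -
      have "emeasure PN (bad i)
          \<le> ennreal (\<epsilon> / K) * (\<integral>\<^sup>+ d. Z (\<gamma>0 i) d * indicator (space PN) d \<partial>PN)"
        unfolding bad_def by (rule nn_integral_Markov_inequality) measurable
      also have "(\<integral>\<^sup>+ d. Z (\<gamma>0 i) d * indicator (space PN) d \<partial>PN) = (\<integral>\<^sup>+ d. Z (\<gamma>0 i) d \<partial>PN)"
        by (rule nn_integral_cong) simp
      also have "ennreal (\<epsilon> / K) * \<dots> \<le> ennreal (\<epsilon> / K) * 1"
        using \<gamma>0_\<Gamma>[OF that] \<Gamma>_pos by (intro mult_left_mono Z_le) auto
      finally show ?thesis
        using \<epsilon> by (simp add: PN.emeasure_eq_measure)
    qed
    \<comment> \<open>The event depends only on the finitely many representatives and is fixed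
      before \<open>\<gamma>\<close> and \<open>Q\<close>, which makes the bound
      simultaneous.\<close>
    define B where "B = space PN - (\<Union>i\<in>I. bad i)"
    have "finite I"
      by (simp add: I_def)
    have B: "B \<in> sets (\<Pi>\<^sub>M i\<in>{1..N}. borel)"
      using \<open>finite I\<close> bad unfolding B_def sets_PN[symmetric]
      by (intro sets.Diff sets.top sets.finite_UN) auto
    have "measure PN (\<Union>i\<in>I. bad i) \<le> (\<Sum>i\<in>I. measure PN (bad i))"
      using \<open>finite I\<close> by (intro measure_UNION_le) auto
    also have "\<dots> \<le> (\<Sum>i\<in>I. \<epsilon> / K)"
      by (intro sum_mono bad_le)
    also have "\<dots> = card I / K * \<epsilon>"
      by simp
    also have "\<dots> \<le> 1 * \<epsilon>"
    proof (rule mult_right_mono)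
      have "card I \<le> card {1..K}"
        by (rule card_mono) (auto simp: I_def)
      then show "card I / K \<le> 1"
        by (simp add: divide_le_eq)
    qed (use \<epsilon> in simp)
    finally have "1 - \<epsilon> \<le> measure PN B"
      unfolding B_def using \<open>finite I\<close> by (subst PN.prob_compl) auto
    also have "measure PN B = measure M {\<omega> \<in> space M. D \<omega> \<in> B}"
      unfolding D_law[symmetric] measure_distr[OF D B]
      by (auto intro!: arg_cong[where f="measure M"])
    finally have B_prob: "measure M {\<omega> \<in> space M. D \<omega> \<in> B} \<ge> 1 - \<epsilon>" .

    \<comment> \<open>The risk bound on the good event\<close>
    have "ext_integral Q R \<le> ext_integral Q (\<lambda>h. E h d)
              + (KL_div Q \<mu>H + ereal (ln (real K / \<epsilon>)) + ereal C) / ereal \<gamma>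
              + ereal (\<gamma> / (2 * real N)) * ext_integral Q (\<lambda>h. m h / (\<pi> h)\<^sup>2)"
      if d: "d \<in> B" and \<gamma>: "\<gamma> \<in> \<Gamma>" and Q: "prob_space Q" and sets_Q: "sets Q = sets borel"
        and ac: "absolutely_continuous \<mu>H Q" for d \<gamma> Q
    proof -
      have d_PN: "d \<in> space PN"
        using d by (simp add: B_def)
      then have dE: "d \<in> {1..N} \<rightarrow>\<^sub>E UNIV"
        by (simp add: PN_def \<mu>P_eq space_PiM)
      have "0 < \<gamma>"
        using \<gamma> \<Gamma>_pos by auto
      from \<gamma> cover obtain i where i: "i \<in> {1..K}" "\<gamma> \<in> \<O> i"
        by auto
      then have iI: "i \<in> I" and "K > 0"
        by (auto simp: I_def)
      \<comment> \<open>Positivity and finiteness ensure that \<open>log_partition\<close> is the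
        true logarithm, free of the default values of \<open>ln\<close> and
        \<open>enn2real\<close>.\<close>
      have Z_real: "\<exists>z>0. Z \<gamma>' d = ennreal z" if "\<gamma>' \<in> \<Gamma>" for \<gamma>'
        using part_fin[OF that dE] unfolding Z_def[symmetric]
        by (cases "Z \<gamma>' d") auto
      obtain z where z: "0 < z" "Z \<gamma> d = ennreal z"
        using Z_real[OF \<gamma>] by auto
      obtain z0 where z0: "0 < z0" "Z (\<gamma>0 i) d = ennreal z0"
        using Z_real[OF \<gamma>0_\<Gamma>[OF iI]] by auto
      have "\<not> 1 \<le> ennreal (\<epsilon> / K) * Z (\<gamma>0 i) d"
        using d iI d_PN by (auto simp: B_def bad_def)
      then have "\<epsilon> / K * z0 < 1"
        using z0 \<epsilon> by (simp add: ennreal_mult[symmetric])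
      then have "z0 \<le> K / \<epsilon>"
        using \<epsilon> \<open>K > 0\<close> by (simp add: field_simps)
      then have "ln z0 \<le> ln (K / \<epsilon>)"
        using z0 by simp
      \<comment> \<open>Since \<open>\<gamma>\<close> and \<open>\<gamma>0 i\<close> lie in the same
        set of the covering, passing from the representative to \<open>\<gamma>\<close> costs at
        most \<open>C\<close>.\<close>
      moreover have "ln z - ln z0 \<le> C"
      proof -
        let ?\<kappa> = "\<lambda>\<gamma>. log_partition N \<mu>P \<mu>H cond L g \<gamma> d"
        have "ereal (?\<kappa> \<gamma> - ?\<kappa> (\<gamma>0 i))
            \<le> (SUP (\<gamma>, \<gamma>') \<in> \<O> i \<times> \<O> i. ereal (?\<kappa> \<gamma> - ?\<kappa> \<gamma>'))"
          using i(2) \<gamma>0[OF iI] by (intro SUP_upper2[where i="(\<gamma>, \<gamma>0 i)"]) auto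
        also have "\<dots> \<le> (MAX i\<in>{1..K}. SUP (\<gamma>, \<gamma>') \<in> \<O> i \<times> \<O> i. ereal (?\<kappa> \<gamma> - ?\<kappa> \<gamma>'))"
          using i(1) by (intro Max_ge) auto
        also have "\<dots> \<le> ereal C"
          by (rule osc[OF dE])
        finally show ?thesis
          using z z0 by (simp add: log_partition_def Z_def)
      qed
      ultimately have lnz: "ln z \<le> ln (K / \<epsilon>) + C"
        by simp

      \<comment> \<open>The coefficient of the moment term after division by
        \<open>\<gamma>\<close>; before it, \<open>\<gamma> * w\<close> equals the
        \<open>\<gamma>\<^sup>2 / (2 * N)\<close> in the exponent of \<open>Z\<close>.\<close>
      define w where "w = \<gamma> / (2 * real N)"
      have "0 < w"
        using \<open>0 < \<gamma>\<close> N by (simp add: w_def)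
      have [measurable_cong]: "sets Q = sets borel"
        by (rule sets_Q)
      have [measurable]: "(\<lambda>h. E h d) \<in> borel_measurable borel"
        using measurable_compose[OF measurable_Pair2'[OF d_PN] E] by simp
      \<comment> \<open>The exponent of \<open>Z \<gamma> d\<close> is split by sign: the true risk
        is kept on the left, while the empirical risk and the moment term, both nonnegative, move to
        the right.\<close>
      have "ext_integral Q (\<lambda>h. \<gamma> * R h) \<le> KL_div Q \<mu>H + ereal (ln z)
          + ext_integral Q (\<lambda>h. \<gamma> * E h d + \<gamma> * w * (m h / (\<pi> h)\<^sup>2))"
      proof (rule Donsker_Varadhan[OF \<mu>H.prob_space_axioms Q ac])
        show "(\<integral>\<^sup>+ h. ennreal (exp (\<gamma> * R h - (\<gamma> * E h d + \<gamma> * w * (m h / (\<pi> h)\<^sup>2)))) \<partial>\<mu>H)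
            = ennreal z"
          unfolding z(2)[symmetric] Z_eq
          by (rule nn_integral_cong) (simp add: w_def algebra_simps power2_eq_square)
      qed (use \<open>0 < \<gamma>\<close> \<open>0 < w\<close> z R0 E0 m0 in \<open>auto simp: sets_Q \<mu>H_eq\<close>)
      also have "ext_integral Q (\<lambda>h. \<gamma> * E h d + \<gamma> * w * (m h / (\<pi> h)\<^sup>2))
          = ereal \<gamma> * ext_integral Q (\<lambda>h. E h d)
            + ereal (\<gamma> * w) * ext_integral Q (\<lambda>h. m h / (\<pi> h)\<^sup>2)"
        using \<open>0 < \<gamma>\<close> \<open>0 < w\<close> E0 m0
          ext_integral_cmult_nonneg[of "\<lambda>h. m h / (\<pi> h)\<^sup>2" Q "\<gamma> * w"]
        by (simp add: ext_integral_add_nonneg ext_integral_cmult_nonneg)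
      finally have "ereal \<gamma> * ext_integral Q R \<le> KL_div Q \<mu>H + ereal (ln z)
          + (ereal \<gamma> * ext_integral Q (\<lambda>h. E h d)
            + ereal (\<gamma> * w) * ext_integral Q (\<lambda>h. m h / (\<pi> h)\<^sup>2))"
        using \<open>0 < \<gamma>\<close> R0 by (simp add: ext_integral_cmult_nonneg)
      then show ?thesis
        unfolding w_def[symmetric]
        by (intro PAC_Bayes_rearrange[where c="ln z"])
          (use \<open>0 < \<gamma>\<close> \<open>0 < w\<close> R0 E0 m0 lnz
            KL_div_not_MInf[OF \<mu>H.prob_space_axioms Q ac] in
            \<open>auto simp: ext_integral_nonneg sets_Q \<mu>H_eq\<close>)
    qed
    then show ?thesis
      using B B_prob by (auto simp: R_def E_def m_def \<pi>_def)
  qed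
qed

end
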